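(* Let $c$ be a real number with $-1<c<0$ and let $f:\mathbb{R}^2\to\mathbb{R}^2$, $f(x,y)=(xy+c,x)$. Then $$\mathcal{K}^+=W^s(\alpha)\cup W^s(\theta)\cup W^s(p)\cup W^s(f(p))\cup W^s(f^2(p)),$$ where $p=(-1,-1)$, $\alpha=(a_1,a_1)$ and $\theta=(a_2,a_2)$.
   Context: Here $a_1=\frac{1-\sqrt{1-4c}}{2}$ and $a_2=\frac{1+\sqrt{1-4c}}{2}$, so $\alpha$ and $\theta$ are the two fixed points of $f$; the points $p=(-1,-1)$, $f(p)=(1+c,-1)$, $f^2(p)=(-1,1+c)$ form the $3$-cycle of $f$. The forward filled Julia set is $\mathcal{K}^+=\{(x,y)\in\mathbb{R}^2:(f^n(x,y))_{n\ge 0}\text{ is bounded}\}$, where $f^n$ is the $n$-th iterate of $f$. For $\tau\in\{\alpha,\theta,p,f(p),f^2(p)\}$ the stable manifold is $W^s(\tau)=\{z\in\mathbb{R}^2:\lim_{n\to+\infty}d(f^n(z),f^n(\tau))=0\}$, with $d$ the Euclidean distance. *)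

theory Defs
  imports "HOL-Analysis.Analysis"
begin

(* The plane is real * real; its library metric is the Euclidean one (dist_prod_def). *)

definition fmap :: "real \<Rightarrow> real \<times> real \<Rightarrow> real \<times> real" where
  "fmap c = (\<lambda>(x, y). (x * y + c, x))"

definition fwd_filled_julia :: "('a::metric_space \<Rightarrow> 'a) \<Rightarrow> 'a set" where
  "fwd_filled_julia f = {z. bounded (range (\<lambda>n. (f ^^ n) z))}"

definition stable_manifold :: "('a::metric_space \<Rightarrow> 'a) \<Rightarrow> 'a \<Rightarrow> 'a set" where
  "stable_manifold f \<tau> = {z. (\<lambda>n. dist ((f ^^ n) z) ((f ^^ n) \<tau>)) \<longlonglongrightarrow> 0}"

definition a1 :: "real \<Rightarrow> real" where
  "a1 c = (1 - sqrt (1 - 4 * c)) / 2"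

definition a2 :: "real \<Rightarrow> real" where
  "a2 c = (1 + sqrt (1 - 4 * c)) / 2"

end

theory Submission
  imports Defs
begin

text \<open>
  An orbit of \<open>f(x, y) = (xy + c, x)\<close> is the same thing as a real sequence with
  \<open>x\<^sub>n\<^sub>+\<^sub>2 = x\<^sub>n\<^sub>+\<^sub>1 x\<^sub>n + c\<close>, its points being the pairs of consecutive terms. Two facts give
  the theorem: every bounded sequence of this kind approaches a solution of period \<open>6\<close>
  (\<open>bounded_orbit_asymptotically_periodic\<close>), and the only solutions of period \<open>6\<close> are the two
  fixed points and the three phases of the \<open>3\<close>-cycle (\<open>period_six_cases\<close>). The converse inclusion
  is clear, since an orbit that approaches a periodic orbit is bounded.

  The first fact rests on the signs. Suppose that the signs of the terms are multiplicative, each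
  being the product of the two before it, as for \<open>+++\<dots>\<close> and \<open>-+--+-\<dots>\<close>. Then the absolute values
  satisfy \<open>y\<^sub>n\<^sub>+\<^sub>2 = y\<^sub>n\<^sub>+\<^sub>1 y\<^sub>n \<plusminus> c\<close>, with a sign that depends on \<open>n\<close> modulo \<open>3\<close>, and this recurrence
  is monotone. The differences \<open>y\<^sub>n\<^sub>+\<^sub>6 - y\<^sub>n\<close> therefore keep a common sign once two consecutive ones
  have it; otherwise they alternate strictly, and as \<open>6\<close> is even, the sign depends only on the
  residue class of \<open>n\<close>. Either way, \<open>y\<close> is eventually monotone along every residue class modulo \<open>6\<close>,
  so boundedness yields limits (\<open>asymptotically_periodic_if_sign_coherent\<close>).

  It remains to see which signs occur. After a negative term, a nonnegative term is followed by two
  negative ones. If the term after these is nonnegative every time, the pattern is \<open>-+--+-\<dots>\<close>. If it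
  is negative once, then the terms have become so small that the orbit stays negative
  (\<open>negative_after_three_negatives\<close>). For a negative orbit the recurrence reverses the order, and
  comparing its upper and lower limits shows that it converges (\<open>convergent_product_map\<close>).
\<close>

section \<open>Orbits as solutions of a second order recurrence\<close>

definition recurrence :: "real \<Rightarrow> (nat \<Rightarrow> real) \<Rightarrow> bool" where
  "recurrence c x \<longleftrightarrow> (\<forall>n. x (n + 2) = x (n + 1) * x n + c)"

lemma recurrenceD: "recurrence c x \<Longrightarrow> x (n + 2) = x (n + 1) * x n + c"
  by (simp add: recurrence_def)

lemma recurrence_shift:
  assumes "recurrence c x"
  shows "recurrence c (\<lambda>n. x (n + N))"
  unfolding recurrence_def
proof
  fix n
  show "x (n + 2 + N) = x (n + 1 + N) * x (n + N) + c"
    using recurrenceD[OF assms, of "n + N"] by (simp add: ac_simps)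
qed

lemma recurrence_snd_orbit: "recurrence c (\<lambda>n. snd ((fmap c ^^ n) z))"
  by (simp add: recurrence_def fmap_def case_prod_beta)

lemma orbit_eq_snd_orbit:
  "(fmap c ^^ n) z = (snd ((fmap c ^^ (n + 1)) z), snd ((fmap c ^^ n) z))"
  by (simp add: fmap_def case_prod_beta prod_eq_iff)

lemma orbit_of_recurrence:
  assumes "recurrence c x"
  shows "(fmap c ^^ n) (x 1, x 0) = (x (n + 1), x n)"
proof (induction n)
  case (Suc n)
  then show ?case
    using recurrenceD[OF assms, of n] by (simp add: fmap_def)
qed simp

text \<open>Period \<open>6\<close> rather than \<open>3\<close>: the monotonicity argument needs an even period, and it must be a multiple
  of \<open>3\<close> to fit the sign pattern. Solutions of period \<open>6\<close> are classified separately.\<close>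

definition asymptotically_periodic :: "real \<Rightarrow> (nat \<Rightarrow> real) \<Rightarrow> bool" where
  "asymptotically_periodic c x \<longleftrightarrow>
     (\<exists>L. recurrence c L \<and> (\<forall>n. L (n + 6) = L n) \<and> (\<lambda>n. x n - L n) \<longlonglongrightarrow> 0)"

lemma period_mult:
  fixes L :: "nat \<Rightarrow> 'a"
  assumes "\<And>n. L (n + p) = L n"
  shows "L (n + p * k) = L n"
proof (induction k)
  case (Suc k)
  then show ?case
    using assms[of "n + p * k"] by (simp add: algebra_simps)
qed simp

lemma asymptotically_periodic_if_tail:
  assumes "asymptotically_periodic c (\<lambda>n. x (n + N))"
  shows "asymptotically_periodic c x"
proof -
  obtain L where L: "recurrence c L" "\<And>n. L (n + 6) = L n"
    and lim: "(\<lambda>n. x (n + N) - L n) \<longlonglongrightarrow> 0"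
    using assms unfolding asymptotically_periodic_def by blast
  \<comment> \<open>The limit solution must be moved back by \<open>N\<close>, which modulo \<open>6\<close> is a move forward by \<open>5 N\<close>.\<close>
  have "L (n + N + 5 * N) = L n" for n
    using period_mult[of L 6 n N, OF L(2)] by (simp add: algebra_simps)
  then have "(\<lambda>n. x (n + N) - L (n + N + 5 * N)) \<longlonglongrightarrow> 0"
    using lim by simp
  then have "(\<lambda>n. x n - L (n + 5 * N)) \<longlonglongrightarrow> 0"
    by (rule LIMSEQ_offset)
  moreover have "recurrence c (\<lambda>n. L (n + 5 * N))"
    by (rule recurrence_shift[OF L(1)])
  moreover have "\<forall>n. L (n + 6 + 5 * N) = L (n + 5 * N)"
    using L(2) by (metis add.assoc add.commute)
  ultimately show ?thesis
    unfolding asymptotically_periodic_def by blast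
qed

section \<open>Periodic points of period six\<close>

text \<open>With \<open>\<delta>\<^sub>n = L\<^sub>n\<^sub>+\<^sub>3 - L\<^sub>n\<close> and the midpoints \<open>\<mu>\<^sub>n = (L\<^sub>n + L\<^sub>n\<^sub>+\<^sub>3) / 2\<close>, the recurrence gives
  \<open>\<delta>\<^sub>n\<^sub>+\<^sub>2 = \<delta>\<^sub>n\<^sub>+\<^sub>1 \<mu>\<^sub>n + \<mu>\<^sub>n\<^sub>+\<^sub>1 \<delta>\<^sub>n\<close>. Period \<open>6\<close> means \<open>\<delta>\<^sub>n\<^sub>+\<^sub>3 = - \<delta>\<^sub>n\<close>, so this is a closed linear
  system in \<open>\<delta>\<^sub>0, \<delta>\<^sub>1, \<delta>\<^sub>2\<close>, and it says that this vector equals a skew-symmetric matrix applied to it.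
  Hence it is orthogonal to itself, that is, zero.\<close>

lemma period_six_imp_three:
  assumes "recurrence c L" and per: "\<And>n. L (n + 6) = L n"
  shows "L (n + 3) = L n"
proof -
  have six: "L 3 = L 0 \<and> L 4 = L 1 \<and> L 5 = L 2"
    if "recurrence c L" and per: "\<And>n. L (n + 6) = L n" for L :: "nat \<Rightarrow> real"
  proof -
    define a b d where "a = L 3 - L 0" "b = L 4 - L 1" "d = L 5 - L 2"
    define u v w where "u = (L 0 + L 3) / 2" "v = (L 1 + L 4) / 2" "w = (L 2 + L 5) / 2"
    note defs = a_b_d_def u_v_w_def
    have p: "L 6 = L 0" "L 7 = L 1"
      using per[of 0] per[of 1] by (simp_all add: eval_nat_numeral)
    have r: "L 2 = L 1 * L 0 + c" "L 3 = L 2 * L 1 + c" "L 4 = L 3 * L 2 + c"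
      "L 5 = L 4 * L 3 + c" "L 0 = L 5 * L 4 + c" "L 1 = L 0 * L 5 + c"
      using recurrenceD[OF that(1), of 0] recurrenceD[OF that(1), of 1]
        recurrenceD[OF that(1), of 2] recurrenceD[OF that(1), of 3]
        recurrenceD[OF that(1), of 4] recurrenceD[OF that(1), of 5] p
      by (simp_all add: eval_nat_numeral)
    have "d = (L 4 * L 3 + c) - (L 1 * L 0 + c)"
      using r(1,4) by (simp add: defs)
    then have d: "d = b * u + v * a"
      by (simp add: defs field_simps)
    have "a = (L 2 * L 1 + c) - (L 5 * L 4 + c)"
      using r(2,5) by (simp add: defs)
    then have a: "a = - d * v - w * b"
      by (simp add: defs field_simps)
    have "b = (L 3 * L 2 + c) - (L 0 * L 5 + c)"
      using r(3,6) by (simp add: defs)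
    then have b: "b = a * w - u * d"
      by (simp add: defs field_simps)
    have "a * a + b * b + d * d = a * (- d * v - w * b) + b * (a * w - u * d) + d * (b * u + v * a)"
      using a b d by metis
    also have "\<dots> = 0"
      by (simp add: algebra_simps)
    finally have "a = 0 \<and> b = 0 \<and> d = 0"
      by (smt (verit) zero_le_square mult_eq_0_iff)
    then show ?thesis
      by (simp add: defs)
  qed
  have "L (0 + n + 6) = L (0 + n)" for n
    using per by simp
  then show ?thesis
    using six[of "\<lambda>m. L (m + n)", OF recurrence_shift[OF assms(1)]] per
    by (metis (no_types, lifting) add.assoc add.commute add_0)
qed

lemma fixed_point_cases:
  assumes "c < 0" "t = t * t + c"
  shows "t = a1 c \<or> t = a2 c"
proof -
  have "(2 * t - 1)\<^sup>2 = 1 - 4 * c"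
    using assms(2) by (simp add: power2_eq_square algebra_simps)
  then have "sqrt (1 - 4 * c) = \<bar>2 * t - 1\<bar>"
    by (metis real_sqrt_abs)
  then show ?thesis
    by (auto simp: a1_def a2_def abs_if field_simps)
qed

text \<open>Subtracting consecutive instances of the recurrence around a \<open>3\<close>-cycle gives the equations
  \<open>(1 + L\<^sub>i) (L\<^sub>j - L\<^sub>k) = 0\<close> for the three cyclic labellings \<open>i, j, k\<close>. So either all three values
  agree, or two of them are \<open>-1\<close> and the recurrence makes the third one \<open>1 + c\<close>.\<close>

lemma period_six_cases:
  assumes "c < 0" "recurrence c L" "\<And>n. L (n + 6) = L n"
  shows "(L 1, L 0) \<in> {(a1 c, a1 c), (a2 c, a2 c), (-1, -1), (1 + c, -1), (-1, 1 + c)}"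
proof -
  have p: "L 3 = L 0" "L 4 = L 1"
    using period_six_imp_three[OF assms(2,3), of 0] period_six_imp_three[OF assms(2,3), of 1]
    by (simp_all add: eval_nat_numeral)
  have r: "L 2 = L 1 * L 0 + c" "L 0 = L 2 * L 1 + c" "L 1 = L 0 * L 2 + c"
    using recurrenceD[OF assms(2), of 0] recurrenceD[OF assms(2), of 1]
      recurrenceD[OF assms(2), of 2] p
    by (simp_all add: eval_nat_numeral)
  have "L 2 - L 0 = (L 1 * L 0 + c) - (L 2 * L 1 + c)" "L 0 - L 1 = (L 2 * L 1 + c) - (L 0 * L 2 + c)"
    "L 1 - L 2 = (L 0 * L 2 + c) - (L 1 * L 0 + c)"
    using r by metis+
  then have "(1 + L 1) * (L 2 - L 0) = 0" "(1 + L 2) * (L 0 - L 1) = 0" "(1 + L 0) * (L 1 - L 2) = 0"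
    by (simp_all add: algebra_simps)
  then consider "L 0 = L 1" "L 1 = L 2" | "L 0 = -1" "L 1 = -1" | "L 0 = -1" "L 2 = -1" | "L 1 = -1" "L 2 = -1"
    by force
  then show ?thesis
  proof cases
    case 1
    then have "L 0 = L 0 * L 0 + c"
      using r(1) by metis
    then show ?thesis
      using fixed_point_cases[OF assms(1)] 1(1) by fastforce
  next
    case 2
    then show ?thesis by simp
  next
    case 3
    then have "L 1 = 1 + c"
      using r(3) by simp
    then show ?thesis
      using 3 by simp
  next
    case 4
    then have "L 0 = 1 + c"
      using r(2) by simp
    then show ?thesis
      using 4 by simp
  qed
qed

section \<open>Orbits whose signs are compatible with the recurrence\<close>

lemma tendsto_if_residue_classes:
  fixes g :: "nat \<Rightarrow> real"
  assumes "p > 0" "\<And>i. (\<lambda>j. g (p * j + i)) \<longlonglongrightarrow> l"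
  shows "g \<longlonglongrightarrow> l"
proof (rule tendstoI)
  fix e :: real
  assume "e > 0"
  then have "\<forall>\<^sub>F j in sequentially. \<forall>i\<in>{..<p}. dist (g (p * j + i)) l < e"
    by (intro eventually_ball_finite) (auto intro: tendstoD[OF assms(2)])
  then obtain J where J: "\<And>j i. j \<ge> J \<Longrightarrow> i < p \<Longrightarrow> dist (g (p * j + i)) l < e"
    unfolding eventually_sequentially by blast
  have "dist (g n) l < e" if "n \<ge> p * J" for n
  proof -
    have "n div p \<ge> J"
      using that assms(1) by (metis div_le_mono nonzero_mult_div_cancel_left not_gr0)
    then show ?thesis
      using J[of "n div p" "n mod p"] assms(1) by simp
  qed
  then show "\<forall>\<^sub>F n in sequentially. dist (g n) l < e"
    unfolding eventually_sequentially by blast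
qed

lemma convergent_if_eventually_monotone:
  fixes g :: "nat \<Rightarrow> real"
  assumes "\<And>n. \<bar>g n\<bar> \<le> B" and "(\<forall>n\<ge>J. g n \<le> g (Suc n)) \<or> (\<forall>n\<ge>J. g (Suc n) \<le> g n)"
  shows "convergent g"
proof -
  have "Bseq (\<lambda>n. g (n + J))"
    using assms(1) by (intro BseqI'[of _ B]) simp
  moreover have "monoseq (\<lambda>n. g (n + J))"
    using assms(2) by (auto simp: monoseq_Suc)
  ultimately have "convergent (\<lambda>n. g (n + J))"
    by (rule Bseq_monoseq_convergent)
  then show ?thesis
    by (simp add: convergent_ignore_initial_segment)
qed

text \<open>Applied to the differences \<open>y\<^sub>n\<^sub>+\<^sub>6 - y\<^sub>n\<close> and to their negatives: the recurrence for them is linear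
  with nonnegative coefficients, because \<open>y\<close> is nonnegative.\<close>

lemma pair_nonneg_persists:
  fixes d :: "nat \<Rightarrow> real"
  assumes "\<And>n. d (n + 2) = A n * d (n + 1) + B n * d n" "\<And>n. A n \<ge> 0" "\<And>n. B n \<ge> 0"
    and "d N \<ge> 0" "d (N + 1) \<ge> 0" "n \<ge> N"
  shows "d n \<ge> 0"
proof -
  have "d (N + m) \<ge> 0 \<and> d (N + m + 1) \<ge> 0" for m
  proof (induction m)
    case (Suc m)
    then show ?case
      using assms(1)[of "N + m"] assms(2,3)[of "N + m"] by simp
  qed (use assms in simp)
  then show ?thesis
    using assms(6) by (metis le_add_diff_inverse)
qed

text \<open>The recurrence is monotone in both earlier terms, so the period-\<open>6\<close> differences \<open>d\<close> have only two
  possible behaviours: two consecutive ones share a (weak) sign and all later ones inherit it, or the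
  signs alternate strictly for ever. Since \<open>6\<close> is even, the second case too makes \<open>d\<close> of constant
  sign on each residue class modulo \<open>6\<close>.\<close>

lemma subsequences_convergent:
  fixes y e :: "nat \<Rightarrow> real"
  assumes rec: "\<And>n. y (n + 2) = y (n + 1) * y n + e n" and per: "\<And>n. e (n + 6) = e n"
    and nonneg: "\<And>n. y n \<ge> 0" and bnd: "\<And>n. \<bar>y n\<bar> \<le> B"
  shows "convergent (\<lambda>j. y (6 * j + i))"
proof -
  define d where "d n = y (n + 6) - y n" for n
  have dd: "d (n + 2) = y (n + 6) * d (n + 1) + y (n + 1) * d n" for n
  proof -
    have "y (n + 2 + 6) = y (n + 7) * y (n + 6) + e n"
      using rec[of "n + 6"] per[of n] by (simp add: eval_nat_numeral)
    then show ?thesis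
      using rec[of n] by (simp add: d_def algebra_simps)
  qed
  have "\<exists>J. (\<forall>j\<ge>J. d (6 * j + i) \<ge> 0) \<or> (\<forall>j\<ge>J. d (6 * j + i) \<le> 0)"
  proof -
    consider (pos) N where "d N \<ge> 0" "d (N + 1) \<ge> 0" | (neg) N where "d N \<le> 0" "d (N + 1) \<le> 0"
      | (alt) "\<And>N. \<not> (d N \<ge> 0 \<and> d (N + 1) \<ge> 0)" "\<And>N. \<not> (d N \<le> 0 \<and> d (N + 1) \<le> 0)"
      by blast
    then show ?thesis
    proof cases
      case pos
      have "d (6 * j + i) \<ge> 0" if "j \<ge> N" for j
        using that pair_nonneg_persists[of d, OF dd nonneg nonneg pos] by simp
      then show ?thesis by blast
    next
      case neg
      have dd': "- d (n + 2) = y (n + 6) * - d (n + 1) + y (n + 1) * - d n" for n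
        using dd[of n] by simp
      have "- d (6 * j + i) \<ge> 0" if "j \<ge> N" for j
        by (rule pair_nonneg_persists[of "\<lambda>n. - d n", OF dd' nonneg nonneg])
          (use that neg in auto)
      then show ?thesis by force
    next
      case alt
      have two: "d (n + 2) \<ge> 0 \<longleftrightarrow> d n \<ge> 0" for n
        using alt[of n] alt[of "n + 1"] by force
      have "d (n + 6) \<ge> 0 \<longleftrightarrow> d n \<ge> 0" for n
        using two[of n] two[of "n + 2"] two[of "n + 4"] by (simp add: eval_nat_numeral)
      then have "(d (i + 6 * j) \<ge> 0) = (d i \<ge> 0)" for j
        using period_mult[of "\<lambda>n. d n \<ge> 0" 6 i j] by simp
      then show ?thesis
        by (metis add.commute linear)
    qed
  qed
  then obtain J where "(\<forall>j\<ge>J. d (6 * j + i) \<ge> 0) \<or> (\<forall>j\<ge>J. d (6 * j + i) \<le> 0)"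
    by blast
  then show ?thesis
    using bnd by (intro convergent_if_eventually_monotone[of _ B J]) (auto simp: d_def algebra_simps)
qed

text \<open>The hypotheses on \<open>s\<close> let the signs factor out of the recurrence: \<open>y\<^sub>n = s\<^sub>n x\<^sub>n\<close> satisfies
  \<open>y\<^sub>n\<^sub>+\<^sub>2 = y\<^sub>n\<^sub>+\<^sub>1 y\<^sub>n + s\<^sub>n\<^sub>+\<^sub>2 c\<close> and is nonnegative. They also force \<open>s\<close> to have period \<open>3\<close>, so the
  limits along the residue classes modulo \<open>6\<close> form a solution.\<close>

lemma asymptotically_periodic_if_sign_coherent:
  fixes x s :: "nat \<Rightarrow> real"
  assumes rec: "recurrence c x" and bnd: "\<And>n. \<bar>x n\<bar> \<le> B"
    and s: "\<And>n. s (n + 2) = s (n + 1) * s n" "\<And>n. s n * s n = 1"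
    and sx: "\<And>n. s n * x n \<ge> 0"
  shows "asymptotically_periodic c x"
proof -
  define y where "y n = s n * x n" for n
  have three: "s (n + 3) = s n" for n
    using s(1)[of "n + 1"] s(1)[of n] s(2)[of "n + 1"]
    by (simp add: eval_nat_numeral mult.assoc mult.left_commute)
  have six: "s (n + 6) = s n" for n
    using three[of "n + 3"] three[of n] by (simp add: add.assoc)
  have abs_s: "\<bar>s n\<bar> = 1" for n
    using s(2)[of n] by (metis abs_1 abs_mult_self_eq power2_eq_square abs_square_eq_1)
  have xy: "x n = s n * y n" for n
    using s(2)[of n] by (simp add: y_def flip: mult.assoc)
  have conv: "convergent (\<lambda>j. y (6 * j + i))" for i
  proof (rule subsequences_convergent)
    show "y (n + 2) = y (n + 1) * y n + s (n + 2) * c" for n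
      using recurrenceD[OF rec, of n] s(1)[of n] by (simp add: y_def algebra_simps)
    show "s (n + 6 + 2) * c = s (n + 2) * c" for n
      using six[of "n + 2"] by (simp add: algebra_simps)
    show "y n \<ge> 0" for n
      using sx by (simp add: y_def)
    show "\<bar>y n\<bar> \<le> B" for n
      using bnd abs_s by (simp add: y_def abs_mult)
  qed
  have "convergent (\<lambda>j. x (6 * j + i))" for i
  proof -
    have "s (6 * j + i) = s i" for j
      using period_mult[of s 6 i j, OF six] by (simp add: add.commute)
    then have "(\<lambda>j. x (6 * j + i)) = (\<lambda>j. s i * y (6 * j + i))"
      using xy by auto
    then show ?thesis
      using conv[of i] by (simp add: convergent_mult convergent_const)
  qed
  then obtain L where L: "\<And>i. (\<lambda>j. x (6 * j + i)) \<longlonglongrightarrow> L i"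
    unfolding convergent_def by metis
  have "recurrence c L"
    unfolding recurrence_def
  proof
    fix n
    have "(\<lambda>j. x (6 * j + (n + 1)) * x (6 * j + n) + c) \<longlonglongrightarrow> L (n + 1) * L n + c"
      by (intro tendsto_intros L)
    moreover have "x (6 * j + (n + 1)) * x (6 * j + n) + c = x (6 * j + (n + 2))" for j
      using recurrenceD[OF rec, of "6 * j + n"] by (simp add: add.assoc)
    ultimately have "(\<lambda>j. x (6 * j + (n + 2))) \<longlonglongrightarrow> L (n + 1) * L n + c"
      by simp
    then show "L (n + 2) = L (n + 1) * L n + c"
      using L LIMSEQ_unique by blast
  qed
  moreover have per: "L (n + 6) = L n" for n
  proof -
    have "(\<lambda>j. x (6 * Suc j + n)) \<longlonglongrightarrow> L n"
      by (rule LIMSEQ_Suc[OF L])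
    then have "(\<lambda>j. x (6 * j + (n + 6))) \<longlonglongrightarrow> L n"
      by (simp add: algebra_simps)
    then show ?thesis
      using L LIMSEQ_unique by blast
  qed
  moreover have "(\<lambda>n. x n - L n) \<longlonglongrightarrow> 0"
  proof (rule tendsto_if_residue_classes[of 6])
    fix i
    have "L (6 * j + i) = L i" for j
      using period_mult[of L 6 i j, OF per] by (simp add: add.commute)
    then show "(\<lambda>j. x (6 * j + i) - L (6 * j + i)) \<longlonglongrightarrow> 0"
      using L[of i] by (simp add: LIM_zero)
  qed simp
  ultimately show ?thesis
    unfolding asymptotically_periodic_def by blast
qed

section \<open>Negative orbits\<close>

text \<open>The inequalities that the lower limit \<open>I\<close> and the upper limit \<open>S\<close> of a solution of
  \<open>y\<^sub>n\<^sub>+\<^sub>2 = k - y\<^sub>n\<^sub>+\<^sub>1 y\<^sub>n\<close> satisfy. The one-step bounds \<open>S \<le> k - I\<^sup>2\<close> and \<open>k - S\<^sup>2 \<le> I\<close> alone would not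
  force \<open>I = S\<close> when \<open>k\<close> is close to \<open>1\<close>, which is why the upper bound comes from two steps. If its
  first alternative holds, it factors to \<open>S (1 + I) \<le> k\<close>, which with \<open>lower\<close> gives
  \<open>(S - I) (1 - S) \<le> 0\<close>; if the second one holds, it factors to \<open>S\<^sup>2 + S \<le> k\<close>, so that
  \<open>S \<le> k - S\<^sup>2 \<le> I\<close>.\<close>

lemma oscillation_zero:
  fixes k I S :: real
  assumes "0 \<le> I" "I \<le> S" "S \<le> k" "0 < k" "k < 1"
    and upper: "S \<le> max (k - k * I + I * I * S) (k - k * S + S * S * S)"
    and lower: "k - S * S \<le> I"
  shows "I = S"
proof -
  consider "S \<le> k - k * I + I * I * S" | "S \<le> k - k * S + S * S * S"
    using upper by linarith
  then show ?thesis
  proof cases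
    case 1
    then have "(1 - I) * (S * (1 + I) - k) \<le> 0"
      by (simp add: algebra_simps)
    then have "S * (1 + I) \<le> k"
      using assms by (simp add: mult_le_0_iff)
    then have "(S - I) * (1 - S) \<le> 0"
      using lower by (simp add: algebra_simps)
    then show ?thesis
      using assms by (simp add: mult_le_0_iff)
  next
    case 2
    then have "(1 - S) * (S * S + S - k) \<le> 0"
      by (simp add: algebra_simps)
    then have "S * S + S - k \<le> 0"
      using assms by (simp add: mult_le_0_iff)
    then show ?thesis
      using lower assms by linarith
  qed
qed

text \<open>Substituting the recurrence into itself gives \<open>y\<^sub>n\<^sub>+\<^sub>3 = k - k u + u\<^sup>2 v\<close> with \<open>u = y\<^sub>n\<^sub>+\<^sub>1\<close> and \<open>v = y\<^sub>n\<close>.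
  This increases in \<open>v\<close> and is convex in \<open>u\<close>, so over the range \<open>[I, S]\<close> of the later terms it is
  largest at \<open>v = S\<close> and \<open>u = I\<close> or \<open>u = S\<close>: this is the upper bound that \<open>oscillation_zero\<close> asks for.\<close>

lemma convergent_product_map:
  fixes y :: "nat \<Rightarrow> real"
  assumes k: "0 < k" "k < 1" and rec: "\<And>n. y (n + 2) = k - y (n + 1) * y n"
    and y: "\<And>n. 0 \<le> y n" "\<And>n. y n \<le> k"
  shows "convergent y"
proof -
  define S I where "S n = (SUP m\<in>{n..}. y m)" and "I n = (INF m\<in>{n..}. y m)" for n
  have bdd: "bdd_above (y ` A)" "bdd_below (y ` A)" for A
    using y by (auto simp: bdd_above_def bdd_below_def)
  have yS: "y m \<le> S n" and yI: "I n \<le> y m" if "m \<ge> n" for m n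
    using that unfolding S_def I_def by (auto intro!: cSUP_upper cINF_lower bdd)
  have S_le: "S n \<le> u" if "\<And>m. m \<ge> n \<Longrightarrow> y m \<le> u" for u n
    unfolding S_def using that by (intro cSUP_least) auto
  have I_ge: "u \<le> I n" if "\<And>m. m \<ge> n \<Longrightarrow> u \<le> y m" for u n
    unfolding I_def using that by (intro cINF_greatest) auto
  have IS: "I n \<le> S n" for n
    using yS[of n n] yI[of n n] by simp
  have I0: "0 \<le> I n" and Sk: "S n \<le> k" for n
    using y by (auto intro: I_ge S_le)
  have "convergent S"
  proof (rule convergent_if_eventually_monotone[of _ k 0])
    show "\<bar>S n\<bar> \<le> k" for n
      using I0[of n] IS[of n] Sk[of n] by simp
    show "(\<forall>n\<ge>0. S n \<le> S (Suc n)) \<or> (\<forall>n\<ge>0. S (Suc n) \<le> S n)"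
      by (auto intro!: S_le yS)
  qed
  then obtain s where s: "S \<longlonglongrightarrow> s"
    unfolding convergent_def by blast
  have "convergent I"
  proof (rule convergent_if_eventually_monotone[of _ k 0])
    show "\<bar>I n\<bar> \<le> k" for n
      using I0[of n] IS[of n] Sk[of n] by simp
    show "(\<forall>n\<ge>0. I n \<le> I (Suc n)) \<or> (\<forall>n\<ge>0. I (Suc n) \<le> I n)"
      by (auto intro!: I_ge yI)
  qed
  then obtain i where i: "I \<longlonglongrightarrow> i"
    unfolding convergent_def by blast
  have upper: "S (n + 3) \<le> max (k - k * I n + I n * I n * S n) (k - k * S n + S n * S n * S n)" for n
  proof (rule S_le)
    fix m
    assume "m \<ge> n + 3"
    then obtain l where l: "m = l + 3" "l \<ge> n"
      by (metis add_le_cancel_right le_add_diff_inverse2 le_trans le_add2)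
    define u where "u = y (l + 1)"
    have u: "I n \<le> u" "u \<le> S n" "0 \<le> u"
      using l(2) y by (auto simp: u_def intro: yS yI)
    have "y m = k - (k - y (l + 1) * y l) * y (l + 1)"
      using rec[of "l + 1"] rec[of l] l(1) by (simp add: eval_nat_numeral)
    then have "y m = k - k * u + u * u * y l"
      by (simp add: u_def algebra_simps)
    also have "\<dots> \<le> k - k * u + u * u * S n"
      using yS[OF l(2)] by (simp add: mult_left_mono)
    \<comment> \<open>The bound at an end of the interval: the slope of the chord of the parabola from \<open>u\<close> to \<open>S n\<close> is
      \<open>S n * (S n + u) - k\<close>. If it is nonnegative, the right end wins; otherwise the chord from
      \<open>I n\<close> to \<open>u\<close>, which is no steeper, descends too, and the left end wins.\<close>
    also have "\<dots> \<le> max (k - k * I n + I n * I n * S n) (k - k * S n + S n * S n * S n)"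
    proof (cases "k \<le> S n * (S n + u)")
      case True
      then have "0 \<le> (S n - u) * (S n * (S n + u) - k)"
        using u by simp
      then have "k - k * u + u * u * S n \<le> k - k * S n + S n * S n * S n"
        by (simp add: algebra_simps)
      then show ?thesis by simp
    next
      case False
      have "S n * (I n + u) \<le> S n * (S n + u)"
        using IS[of n] I0[of n] by (intro mult_left_mono) auto
      then have "0 \<le> (u - I n) * (k - S n * (I n + u))"
        using u False by simp
      then have "k - k * u + u * u * S n \<le> k - k * I n + I n * I n * S n"
        by (simp add: algebra_simps)
      then show ?thesis by simp
    qed
    finally show "y m \<le> max (k - k * I n + I n * I n * S n) (k - k * S n + S n * S n * S n)" .
  qed
  have lower: "k - S n * S n \<le> I (n + 2)" for n
  proof (rule I_ge)
    fix m
    assume "m \<ge> n + 2"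
    then obtain l where l: "m = l + 2" "l \<ge> n"
      by (metis add_le_cancel_right le_add_diff_inverse2 le_trans le_add2)
    have "y (l + 1) * y l \<le> S n * S n"
      using l(2) y I0[of n] IS[of n] by (intro mult_mono yS) auto
    then show "k - S n * S n \<le> y m"
      using rec[of l] l(1) by simp
  qed
  have "i = s"
  proof (rule oscillation_zero[OF _ _ _ k])
    show "0 \<le> i"
      using i I0 by (intro LIMSEQ_le_const) auto
    show "i \<le> s"
      using i s IS by (intro LIMSEQ_le) auto
    show "s \<le> k"
      using s Sk by (intro LIMSEQ_le_const2) auto
    have "(\<lambda>n. max (k - k * I n + I n * I n * S n) (k - k * S n + S n * S n * S n))
        \<longlonglongrightarrow> max (k - k * i + i * i * s) (k - k * s + s * s * s)"
      by (intro tendsto_intros i s)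
    then show "s \<le> max (k - k * i + i * i * s) (k - k * s + s * s * s)"
      using LIMSEQ_ignore_initial_segment[OF s, of 3] upper by (intro LIMSEQ_le) auto
    have "(\<lambda>n. k - S n * S n) \<longlonglongrightarrow> k - s * s"
      by (intro tendsto_intros s)
    then show "k - s * s \<le> i"
      using LIMSEQ_ignore_initial_segment[OF i, of 2] lower by (intro LIMSEQ_le) auto
  qed
  then have "y \<longlonglongrightarrow> s"
    using yI yS i s by (intro tendsto_sandwich[of I y _ S]) auto
  then show ?thesis
    by (rule convergentI)
qed

lemma asymptotically_periodic_if_negative:
  assumes c: "-1 < c" "c < 0" and rec: "recurrence c x" and neg: "\<And>n. x n < 0"
  shows "asymptotically_periodic c x"
proof -
  have "convergent (\<lambda>n. - x (n + 2))"
  proof (rule convergent_product_map[of "- c"])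
    show "- x (n + 2 + 2) = - c - - x (n + 1 + 2) * - x (n + 2)" for n
      using recurrenceD[OF rec, of "n + 2"] by (simp add: algebra_simps)
    show "0 \<le> - x (n + 2)" for n
      using neg[of "n + 2"] by linarith
    have "0 \<le> x (n + 1) * x n" for n
      using neg by (intro mult_nonpos_nonpos) (auto intro: less_imp_le)
    then show "- x (n + 2) \<le> - c" for n
      using recurrenceD[OF rec, of n] by simp
  qed (use c in auto)
  then have "convergent (\<lambda>n. - x n)"
    using convergent_ignore_initial_segment[of "\<lambda>n. - x n" 2] by simp
  then have "convergent x"
    by (simp flip: convergent_minus_iff)
  then obtain l where l: "x \<longlonglongrightarrow> l"
    unfolding convergent_def by blast
  have "(\<lambda>n. x (n + 1) * x n + c) \<longlonglongrightarrow> l * l + c"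
    using LIMSEQ_ignore_initial_segment[OF l, of 1] l by (intro tendsto_intros)
  then have "(\<lambda>n. x (n + 2)) \<longlonglongrightarrow> l * l + c"
    using recurrenceD[OF rec] by simp
  then have "l = l * l + c"
    using LIMSEQ_ignore_initial_segment[OF l, of 2] LIMSEQ_unique by blast
  then have "recurrence c (\<lambda>_. l)"
    by (simp add: recurrence_def)
  moreover have "(\<lambda>n. x n - l) \<longlonglongrightarrow> 0"
    using l by (rule LIM_zero)
  ultimately show ?thesis
    unfolding asymptotically_periodic_def by blast
qed

section \<open>Sign patterns of bounded orbits\<close>

text \<open>The product of two numbers in \<open>[c, 0)\<close> lies in \<open>(0, c\<^sup>2]\<close>, and \<open>c\<^sup>2 < - c\<close>, so adding \<open>c\<close> leads back
  into \<open>[c, 0)\<close>.\<close>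

lemma negative_forever:
  assumes c: "-1 < c" "c < 0" and rec: "recurrence c x"
    and "c \<le> x 0" "x 0 < 0" "c \<le> x 1" "x 1 < 0"
  shows "x n < 0"
proof -
  have "c \<le> x n \<and> x n < 0 \<and> c \<le> x (n + 1) \<and> x (n + 1) < 0"
  proof (induction n)
    case (Suc n)
    then have "x (n + 1) * x n \<ge> 0" "x (n + 1) * x n \<le> c * c"
      using mult_mono[of "- x (n + 1)" "- c" "- x n" "- c"] c
      by (auto intro: mult_nonpos_nonpos)
    moreover have "(- c) * (- c) < (- c) * 1"
      using c by (intro mult_strict_left_mono) auto
    ultimately show ?case
      using Suc recurrenceD[OF rec, of n] by simp
  qed (use assms in simp)
  then show ?thesis by simp
qed

text \<open>The nonnegative term \<open>x 1\<close> after a negative one makes \<open>x 2\<close> and \<open>x 3\<close> at most \<open>c\<close>. If nevertheless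
  \<open>x 4 = x 3 * x 2 + c\<close> is negative, then \<open>x 3 * x 2 < - c\<close> and hence \<open>x 3 > -1\<close>. So \<open>x 4\<close> and
  then also \<open>x 5\<close> lie in \<open>[c, 0)\<close>, where the orbit is trapped. Without the preceding nonnegative term
  this can fail: three consecutive negative terms may be of very different size.\<close>

lemma negative_after_three_negatives:
  assumes c: "-1 < c" "c < 0" and rec: "recurrence c x"
    and "x 0 < 0" "0 \<le> x 1" "x 4 < 0"
  shows "x (n + 4) < 0"
proof -
  have r: "x 2 = x 1 * x 0 + c" "x 3 = x 2 * x 1 + c" "x 4 = x 3 * x 2 + c" "x 5 = x 4 * x 3 + c"
    using recurrenceD[OF rec, of 0] recurrenceD[OF rec, of 1] recurrenceD[OF rec, of 2]
      recurrenceD[OF rec, of 3] by (simp_all add: eval_nat_numeral)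
  have x2: "x 2 \<le> c"
    using r(1) assms(4,5) by (simp add: mult_nonneg_nonpos)
  then have x3: "x 3 \<le> c"
    using r(2) assms(5) c by (simp add: mult_nonpos_nonneg)
  have "x 3 > -1"
  proof (rule ccontr)
    assume "\<not> ?thesis"
    then have "1 * (- c) \<le> (- x 3) * (- x 2)"
      using x2 c by (intro mult_mono) auto
    then show False
      using r(3) assms(6) by simp
  qed
  have "0 \<le> (- x 3) * (- x 2)"
    using x2 x3 c by (intro mult_nonneg_nonneg) auto
  then have x4: "c \<le> x 4"
    using r(3) by simp
  have "(- x 4) * (- x 3) < (- c) * 1"
    using x4 \<open>x 3 > -1\<close> assms(6) x3 c by (intro mult_le_less_imp_less) auto
  moreover have "0 \<le> (- x 4) * (- x 3)"
    using x3 c assms(6) by (intro mult_nonneg_nonneg) auto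
  ultimately have x5: "c \<le> x 5" "x 5 < 0"
    using r(4) by simp_all
  have "recurrence c (\<lambda>n. x (n + 4))"
    by (rule recurrence_shift[OF rec])
  then show ?thesis
    by (rule negative_forever[OF c]) (use x4 x5 assms(6) in simp_all)
qed

text \<open>Either the orbit is nonnegative, or it is negative from some point on, or a nonnegative term follows
  a negative one and nonnegative terms keep occurring. In the last case three consecutive negative
  terms are excluded after that point, and the pattern \<open>-+-\<close> repeats with period \<open>3\<close>.\<close>

lemma bounded_orbit_asymptotically_periodic:
  assumes c: "-1 < c" "c < 0" and rec: "recurrence c x" and bnd: "\<And>n. \<bar>x n\<bar> \<le> B"
  shows "asymptotically_periodic c x"
proof -
  consider (nonneg) "\<And>n. 0 \<le> x n" 
    | (neg) N where "\<And>n. x (n + N) < 0"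
    | (mixed) M where "x M < 0" "0 \<le> x (M + 1)" "\<And>N. \<exists>n. 0 \<le> x (n + N)"
  \<comment> \<open>If a negative term is never followed by a nonnegative one, the sign changes at most once.\<close>
  proof (cases "\<exists>M. x M < 0 \<and> 0 \<le> x (M + 1)")
    case True
    then show ?thesis using that(2,3) by (meson not_less)
  next
    case False
    have "x (n + M) < 0" if "x M < 0" for n M
      using that False by (induction n) (auto simp: not_le)
    then show ?thesis using that(1,2) by (meson not_less)
  qed
  then show ?thesis
  proof cases
    case nonneg
    then show ?thesis
      by (intro asymptotically_periodic_if_sign_coherent[OF rec bnd, of "\<lambda>_. 1"]) auto
  next
    case neg
    have "asymptotically_periodic c (\<lambda>n. x (n + N))"
      using neg by (rule asymptotically_periodic_if_negative[OF c recurrence_shift[OF rec]])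
    then show ?thesis
      by (rule asymptotically_periodic_if_tail)
  next
    case mixed
    define N where "N = M + 1"
    have r: "x (n + 2) = x (n + 1) * x n + c" for n
      by (rule recurrenceD[OF rec])
    have step: "x (n + 2) < 0 \<and> x (n + 3) < 0 \<and> 0 \<le> x (n + 4)" if "x n < 0" "0 \<le> x (n + 1)" for n
    proof -
      have "x (n + 1) * x n \<le> 0"
        using that by (simp add: mult_nonneg_nonpos)
      then have 2: "x (n + 2) < 0"
        using r[of n] c by simp
      then have "x (n + 2) * x (n + 1) \<le> 0"
        using that by (simp add: mult_nonpos_nonneg)
      then have 3: "x (n + 3) < 0"
        using r[of "n + 1"] c by (simp add: eval_nat_numeral)
      have "0 \<le> x (n + 4)"
      proof (rule ccontr)
        assume "\<not> ?thesis"
        then have "x (m + 4 + n) < 0" for m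
          using negative_after_three_negatives[OF c recurrence_shift[OF rec, of n], of m] that
          by (simp add: algebra_simps)
        then show False
          using mixed(3)[of "4 + n"] by (metis add.assoc not_less)
      qed
      then show ?thesis using 2 3 by simp
    qed
    have pat: "x (M + 3 * j) < 0 \<and> 0 \<le> x (M + 3 * j + 1)" for j
    proof (induction j)
      case (Suc j)
      then show ?case
        using step[of "M + 3 * j"] by (simp add: algebra_simps)
    qed (use mixed in simp)
    define s :: "nat \<Rightarrow> real" where "s n = (if n mod 3 = 1 then 1 else -1)" for n
    have "asymptotically_periodic c (\<lambda>n. x (n + M))"
    proof (rule asymptotically_periodic_if_sign_coherent[OF recurrence_shift[OF rec] bnd, of s])
      show "s (n + 2) = s (n + 1) * s n" for n
      proof -
        consider "n mod 3 = 0" | "n mod 3 = 1" | "n mod 3 = 2" by linarith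
        then show ?thesis
          by cases (auto simp: s_def mod_add_left_eq[of n, symmetric] mod_Suc numeral_2_eq_2 split: if_splits)
      qed
      show "s n * s n = 1" for n
        by (simp add: s_def)
      show "0 \<le> s n * x (n + M)" for n
      proof -
        define j where "j = n div 3"
        have n: "n = 3 * j + n mod 3"
          by (simp add: j_def)
        have signs: "x (3 * j + M) < 0" "0 \<le> x (3 * j + 1 + M)" "x (3 * j + 2 + M) < 0"
          using pat[of j] step[of "M + 3 * j"] by (simp_all add: algebra_simps)
        consider "n mod 3 = 0" | "n mod 3 = 1" | "n mod 3 = 2" by linarith
        then show ?thesis
          using signs n by cases (auto simp: s_def)
      qed
    qed
    then show ?thesis
      by (rule asymptotically_periodic_if_tail)
  qed
qed

section \<open>Bounded orbits and stable manifolds\<close>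

lemma three_cycle:
  "fmap c (-1, -1) = (1 + c, -1)" "(fmap c ^^ 2) (-1, -1) = (-1, 1 + c)"
  "fmap c (1 + c, -1) = (-1, 1 + c)" "fmap c (-1, 1 + c) = (-1, -1)"
  by (simp_all add: fmap_def eval_nat_numeral)

lemma fixed_points:
  assumes "c < 0"
  shows "fmap c (a1 c, a1 c) = (a1 c, a1 c)" "fmap c (a2 c, a2 c) = (a2 c, a2 c)"
proof -
  have "sqrt (1 - 4 * c) * sqrt (1 - 4 * c) = 1 - 4 * c"
    using assms by simp
  then show "fmap c (a1 c, a1 c) = (a1 c, a1 c)" "fmap c (a2 c, a2 c) = (a2 c, a2 c)"
    by (simp_all add: fmap_def a1_def a2_def field_simps)
qed

lemma stable_manifold_subset_fwd_filled_julia: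
  assumes "bounded (range (\<lambda>n. (f ^^ n) \<tau>))"
  shows "stable_manifold f \<tau> \<subseteq> fwd_filled_julia f"
proof
  fix z
  assume "z \<in> stable_manifold f \<tau>"
  then have "Bseq (\<lambda>n. dist ((f ^^ n) z) ((f ^^ n) \<tau>))"
    by (intro convergent_imp_Bseq convergentI) (simp add: stable_manifold_def)
  then obtain K where K: "\<And>n. dist ((f ^^ n) z) ((f ^^ n) \<tau>) \<le> K"
    by (auto simp: Bseq_def)
  obtain w R where R: "\<And>n. dist w ((f ^^ n) \<tau>) \<le> R"
    using assms by (auto simp: bounded_def)
  have "dist w ((f ^^ n) z) \<le> R + K" for n
    using dist_triangle[of w "(f ^^ n) z" "(f ^^ n) \<tau>"] R[of n] K[of n]
    by (simp add: dist_commute)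
  then show "z \<in> fwd_filled_julia f"
    by (auto simp: fwd_filled_julia_def bounded_def)
qed

lemma fwd_filled_julia_in_stable_manifold:
  assumes c: "-1 < c" "c < 0" and z: "z \<in> fwd_filled_julia (fmap c)"
  shows "\<exists>\<tau>\<in>{(a1 c, a1 c), (a2 c, a2 c), (-1, -1), (1 + c, -1), (-1, 1 + c)}.
    z \<in> stable_manifold (fmap c) \<tau>"
proof -
  define x where "x n = snd ((fmap c ^^ n) z)" for n
  obtain B where B: "\<And>n. norm ((fmap c ^^ n) z) \<le> B"
    using z by (auto simp: fwd_filled_julia_def bounded_iff)
  have "\<bar>x n\<bar> \<le> B" for n
    using B[of n] norm_snd_le[of "snd ((fmap c ^^ n) z)" "fst ((fmap c ^^ n) z)"]
    by (simp add: x_def)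
  moreover have "recurrence c x"
    unfolding x_def by (rule recurrence_snd_orbit)
  ultimately have "asymptotically_periodic c x"
    by (intro bounded_orbit_asymptotically_periodic[OF c])
  then obtain L where L: "recurrence c L" "\<And>n. L (n + 6) = L n"
    and lim: "(\<lambda>n. x n - L n) \<longlonglongrightarrow> 0"
    unfolding asymptotically_periodic_def by blast
  have "(\<lambda>n. sqrt ((x (n + 1) - L (n + 1))\<^sup>2 + (x n - L n)\<^sup>2)) \<longlonglongrightarrow> sqrt (0\<^sup>2 + 0\<^sup>2)"
    using LIMSEQ_ignore_initial_segment[OF lim, of 1] lim by (intro tendsto_intros)
  moreover have "dist ((fmap c ^^ n) z) ((fmap c ^^ n) (L 1, L 0))
      = sqrt ((x (n + 1) - L (n + 1))\<^sup>2 + (x n - L n)\<^sup>2)" for n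
  proof -
    have "(fmap c ^^ n) z = (x (n + 1), x n)"
      unfolding x_def by (rule orbit_eq_snd_orbit)
    then show ?thesis
      by (simp add: orbit_of_recurrence[OF L(1)] dist_prod_def dist_real_def del: One_nat_def)
  qed
  ultimately have "z \<in> stable_manifold (fmap c) (L 1, L 0)"
    by (simp add: stable_manifold_def)
  then show ?thesis
    using period_six_cases[OF c(2) L] by blast
qed

theorem theorem2p2:
  fixes c :: real and f :: "real \<times> real \<Rightarrow> real \<times> real" and p \<alpha> \<theta> :: "real \<times> real"
  assumes "-1 < c" and "c < 0"
    and "f = fmap c"
    and "p = (-1, -1)"
    and "\<alpha> = (a1 c, a1 c)"
    and "\<theta> = (a2 c, a2 c)"
  shows "fwd_filled_julia f =
    stable_manifold f \<alpha> \<union> stable_manifold f \<theta> \<union> stable_manifold f p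
      \<union> stable_manifold f (f p) \<union> stable_manifold f ((f ^^ 2) p)"
proof -
  define T where "T = {(a1 c, a1 c), (a2 c, a2 c), (-1, -1), (1 + c, -1), (-1, 1 + c)}"
  have "stable_manifold f \<tau> \<subseteq> fwd_filled_julia f" if "\<tau> \<in> T" for \<tau>
  proof (rule stable_manifold_subset_fwd_filled_julia)
    have step: "f \<sigma> \<in> T" if "\<sigma> \<in> T" for \<sigma>
      using that three_cycle[of c] fixed_points[OF assms(2)] by (auto simp: T_def assms(3))
    have "(f ^^ n) \<tau> \<in> T" for n
      using that step by (induction n) auto
    then have "range (\<lambda>n. (f ^^ n) \<tau>) \<subseteq> T"
      by blast
    moreover have "bounded T"
      by (simp add: T_def)
    ultimately show "bounded (range (\<lambda>n. (f ^^ n) \<tau>))"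
      by (metis bounded_subset)
  qed
  moreover have "fwd_filled_julia f \<subseteq> (\<Union>\<tau>\<in>T. stable_manifold f \<tau>)"
    using fwd_filled_julia_in_stable_manifold[OF assms(1,2)] by (auto simp: T_def assms(3))
  ultimately have "fwd_filled_julia f = (\<Union>\<tau>\<in>T. stable_manifold f \<tau>)"
    by blast
  then show ?thesis
    using three_cycle[of c] by (simp add: T_def assms(3-6) Un_assoc)
qed

end
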